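(* Suppose treatments are given by $$D_i=h_n(i,\bm{X},\bm{A},\nu_i),\qquad i\in\mathcal{N}_n,$$ where $h_n$ takes values in $\{0,1\}$, and controls are $\mathcal{C}_i=(\bm{X},\bm{A})$ for all $i\in\mathcal{N}_n$. If $\{\nu_j\}_{j=1}^n$ is independently distributed conditional on $(\bm{X},\bm{A})$, then $\{D_i\}_{i=1}^n$ is independently distributed conditional on $(\bm{X},\bm{A})$, and the following $\text{MTP}_2$ property holds: for all $i\in\mathcal{N}_n$ and all $c$ in the support of $\mathcal{C}_i$, the conditional probability mass function $p_i(\cdot\mid c)$ of $\bm{D}=(D_j)_{j=1}^n$ given $\mathcal{C}_i=c$ satisfies, for all $\bm{d},\bm{d}'\in\{0,1\}^n$, $$p_i(\bm{d}\wedge\bm{d}'\mid c)\,p_i(\bm{d}\vee\bm{d}'\mid c)\ \ge\ p_i(\bm{d}\mid c)\,p_i(\bm{d}'\mid c).$$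
   Context: There are $n$ units, $\mathcal{N}_n=\{1,\dots,n\}$. $\bm{A}$ is a (random) network, formally an $n\times n$ matrix; $\bm{X}=(X_i)_{i=1}^n$ is an array of unit-level observables; $\nu_i$ is unit $i$'s private selection unobservable. $\wedge$ and $\vee$ denote the componentwise minimum and maximum. *)

theory Defs
  imports "HOL-Probability.Probability"
begin

text \<open>
  Independence of the family \<open>Y\<close> conditional on a sub-sigma-algebra \<open>F\<close> of \<open>M\<close>: the conditional
  counterpart of \<^const>\<open>prob_space.indep_vars\<close>, where the conditional probability of an event is
  the conditional expectation of its indicator.
\<close>

definition cond_indep_vars ::
  "'w measure \<Rightarrow> 'w measure \<Rightarrow> ('i \<Rightarrow> 's measure) \<Rightarrow> ('i \<Rightarrow> 'w \<Rightarrow> 's) \<Rightarrow> 'i set \<Rightarrow> bool" where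
  "cond_indep_vars M F S Y I \<longleftrightarrow>
    (\<forall>i\<in>I. Y i \<in> measurable M (S i)) \<and>
    (\<forall>J\<subseteq>I. finite J \<longrightarrow> J \<noteq> {} \<longrightarrow>
      (\<forall>B. (\<forall>j\<in>J. B j \<in> sets (S j)) \<longrightarrow>
        (AE \<omega> in M.
          real_cond_exp M F (indicator {\<omega> \<in> space M. \<forall>j\<in>J. Y j \<omega> \<in> B j}) \<omega> =
          (\<Prod>j\<in>J. real_cond_exp M F (indicator {\<omega> \<in> space M. Y j \<omega> \<in> B j}) \<omega>))))"

text \<open>
  \<open>p c\<close> is (a regular version of) the conditional probability mass function of the discrete random
  variable \<open>Y\<close> given \<open>C = c\<close>. Such a version is determined only up to a null set of the law of \<open>C\<close>;
  if \<open>C = c\<close> has positive probability (and \<open>{c}\<close> is measurable), then \<open>pmf (p c) y\<close> is the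
  elementary conditional probability of \<open>Y = y\<close> given \<open>C = c\<close>.
\<close>

definition is_cond_pmf ::
  "'w measure \<Rightarrow> 'c measure \<Rightarrow> ('w \<Rightarrow> 'c) \<Rightarrow> ('w \<Rightarrow> 'y) \<Rightarrow> ('c \<Rightarrow> 'y pmf) \<Rightarrow> bool" where
  "is_cond_pmf M N C Y p \<longleftrightarrow>
    (\<forall>y. (\<lambda>c. pmf (p c) y) \<in> borel_measurable N) \<and>
    (\<forall>y. \<forall>B\<in>sets N.
      measure M {\<omega> \<in> space M. Y \<omega> = y \<and> C \<omega> \<in> B} =
      set_lebesgue_integral (distr M N C) B (\<lambda>c. pmf (p c) y))"

definition rv_support :: "'w measure \<Rightarrow> ('w \<Rightarrow> 'c::topological_space) \<Rightarrow> 'c set" where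
  "rv_support M C =
    {c. \<forall>U. open U \<longrightarrow> c \<in> U \<longrightarrow> measure M {\<omega> \<in> space M. C \<omega> \<in> U} > 0}"

definition binary_vectors :: "('n \<Rightarrow> nat) set" where
  "binary_vectors = {d. \<forall>j. d j \<in> {0, 1}}"

definition MTP2_on :: "('n \<Rightarrow> nat) set \<Rightarrow> (('n \<Rightarrow> nat) \<Rightarrow> real) \<Rightarrow> bool" where
  "MTP2_on E f \<longleftrightarrow>
    (\<forall>d\<in>E. \<forall>d'\<in>E.
      f (\<lambda>j. min (d j) (d' j)) * f (\<lambda>j. max (d j) (d' j)) \<ge> f d * f d')"

end

theory Submission
  imports Defs
begin

text \<open>
  Write \<open>Z = (X, A)\<close>. Independence of the \<open>\<nu>\<^sub>j\<close> given \<open>Z\<close> passes to the pairs \<open>(Z, \<nu>\<^sub>j)\<close>: replace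
  the events \<open>\<nu>\<^sub>j \<in> B\<close> by events \<open>(Z, \<nu>\<^sub>j) \<in> H\<close> one index at a time, each time by a Dynkin class
  argument. Since \<open>D\<^sub>j\<close> is a function of \<open>(Z, \<nu>\<^sub>j)\<close>, the \<open>D\<^sub>j\<close> are conditionally independent, so the
  conditional mass function of \<open>D\<close> factorizes over the coordinates. A product function satisfies
  the \<open>MTP\<^sub>2\<close> inequality with equality, because taking minimum and maximum only permutes the two
  values in each coordinate. The version satisfying it at every point is a product of Bernoulli laws,
  whose parameters are Radon-Nikodym derivatives with respect to the law of \<open>Z\<close>.
\<close>

section \<open>Conditional probabilities given a random variable\<close>

locale conditioning = prob_space M for M :: "'w measure" +
  fixes N :: "'c measure" and Z :: "'w \<Rightarrow> 'c"
  assumes Z [measurable]: "Z \<in> measurable M N"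
begin

abbreviation F :: "'w measure" where "F \<equiv> vimage_algebra (space M) Z N"

abbreviation cprob :: "'w set \<Rightarrow> 'w \<Rightarrow> real" where
  "cprob E \<equiv> real_cond_exp M F (indicator E)"

lemma sets_F: "sets F = {Z -` B \<inter> space M | B. B \<in> sets N}"
  using measurable_space[OF Z] by (intro sets_vimage_algebra2) auto

lemma vimage_in_F [measurable]: "B \<in> sets N \<Longrightarrow> Z -` B \<inter> space M \<in> sets F"
  unfolding sets_F by auto

lemma subalgebra_F: "subalgebra M F"
  unfolding subalgebra_def sets_F using measurable_sets[OF Z] by auto

lemma sets_F_D: "A \<in> sets F \<Longrightarrow> A \<in> events"
  using subalgebra_F by (auto simp: subalgebra_def)

sublocale sigma_finite_subalgebra M F
  by (intro finite_measure_subalgebra_is_sigma_finite)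
     (simp add: finite_measure_subalgebra_def finite_measure_subalgebra_axioms_def
        finite_measure_axioms subalgebra_F)

lemma Z_measurable_F [measurable]: "Z \<in> measurable F N"
  using measurable_space[OF Z] by (intro measurable_vimage_algebra1) auto

lemma integrable_indicator_event [simp, intro]:
  "E \<in> events \<Longrightarrow> integrable M (indicator E :: 'w \<Rightarrow> real)"
  by (intro integrable_real_indicator) (auto simp: less_top[symmetric])

lemma cprob_nonneg: "E \<in> events \<Longrightarrow> AE \<omega> in M. 0 \<le> cprob E \<omega>"
  by (intro real_cond_exp_pos) auto

lemma cprob_le_1: "E \<in> events \<Longrightarrow> AE \<omega> in M. cprob E \<omega> \<le> 1"
  by (intro real_cond_exp_le_c) (auto simp: indicator_def)

lemma cprob_space: "AE \<omega> in M. cprob (space M) \<omega> = 1"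
proof -
  have "AE \<omega> in M. cprob (space M) \<omega> = real_cond_exp M F (\<lambda>_. 1) \<omega>"
    by (intro real_cond_exp_cong) (auto simp: indicator_def)
  moreover have "AE \<omega> in M. real_cond_exp M F (\<lambda>_. 1) \<omega> = (1::real)"
    by (intro real_cond_exp_F_meas) auto
  ultimately show ?thesis by eventually_elim simp
qed

lemma set_integral_comp_Z:
  fixes f :: "'c \<Rightarrow> real"
  assumes [measurable]: "f \<in> borel_measurable N" "B \<in> sets N"
  shows "(LINT c:B|distr M N Z. f c) = (LINT \<omega>:(Z -` B \<inter> space M)|M. f (Z \<omega>))"
  unfolding set_lebesgue_integral_def
  by (subst integral_distr) (auto intro!: Bochner_Integration.integral_cong simp: indicator_def)

text \<open>\<open>F\<close> consists exactly of the preimages under \<open>Z\<close> of sets in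
  \<open>N\<close>, so the integrals over sets of \<open>F\<close> that characterize
  \<open>cprob E\<close> become integrals against the law of \<open>Z\<close>. This links
  \<open>real_cond_exp\<close> with the integral form used in \<open>is_cond_pmf\<close>.\<close>

lemma cprob_eq_comp_iff:
  fixes f :: "'c \<Rightarrow> real"
  assumes [measurable]: "E \<in> events" "f \<in> borel_measurable N"
    and f: "integrable (distr M N Z) f"
  shows "(AE \<omega> in M. cprob E \<omega> = f (Z \<omega>)) \<longleftrightarrow>
    (\<forall>B\<in>sets N. prob {\<omega> \<in> E. Z \<omega> \<in> B} = (LINT c:B|distr M N Z. f c))"
proof -
  have ind: "(LINT \<omega>:(Z -` B \<inter> space M)|M. indicator E \<omega>) = prob {\<omega> \<in> E. Z \<omega> \<in> B}"
    if [measurable]: "B \<in> sets N" for B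
  proof -
    have "(LINT \<omega>:(Z -` B \<inter> space M)|M. indicator E \<omega>) = (LINT \<omega>|M. indicator {\<omega> \<in> E. Z \<omega> \<in> B} \<omega> :: real)"
      unfolding set_lebesgue_integral_def
      by (intro Bochner_Integration.integral_cong)
         (use sets.sets_into_space[OF assms(1)] in \<open>auto simp: indicator_def\<close>)
    also have "\<dots> = prob ({\<omega> \<in> E. Z \<omega> \<in> B} \<inter> space M)"
      by simp
    also have "{\<omega> \<in> E. Z \<omega> \<in> B} \<inter> space M = {\<omega> \<in> E. Z \<omega> \<in> B}"
      using sets.sets_into_space[OF assms(1)] by auto
    finally show ?thesis .
  qed
  have intf: "integrable M (\<lambda>\<omega>. f (Z \<omega>))"
    using integrable_distr[OF Z f] .
  show ?thesis
  proof safe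
    fix B assume eq: "AE \<omega> in M. cprob E \<omega> = f (Z \<omega>)" and [measurable]: "B \<in> sets N"
    have "prob {\<omega> \<in> E. Z \<omega> \<in> B} = (LINT \<omega>:(Z -` B \<inter> space M)|M. cprob E \<omega>)"
      by (subst ind[symmetric]) (auto intro!: real_cond_exp_intA)
    also have "\<dots> = (LINT \<omega>:(Z -` B \<inter> space M)|M. f (Z \<omega>))"
      using eq by (intro set_lebesgue_integral_cong_AE) auto
    finally show "prob {\<omega> \<in> E. Z \<omega> \<in> B} = (LINT c:B|distr M N Z. f c)"
      by (simp add: set_integral_comp_Z)
  next
    assume eq: "\<forall>B\<in>sets N. prob {\<omega> \<in> E. Z \<omega> \<in> B} = (LINT c:B|distr M N Z. f c)"
    show "AE \<omega> in M. cprob E \<omega> = f (Z \<omega>)"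
    proof (rule real_cond_exp_charact)
      fix A assume "A \<in> sets F"
      then obtain B where [measurable]: "B \<in> sets N" and "A = Z -` B \<inter> space M"
        unfolding sets_F by auto
      then show "(LINT \<omega>:A|M. indicator E \<omega>) = (LINT \<omega>:A|M. f (Z \<omega>))"
        using eq ind by (simp add: set_integral_comp_Z)
    qed (use intf in auto)
  qed
qed

text \<open>The function \<open>q\<close> is the Radon-Nikodym derivative, with respect to the law
  of \<open>Z\<close>, of the measure that sends \<open>B\<close> to the probability of
  \<open>E\<close> together with \<open>Z \<in> B\<close>. The bounds hold at every point, not just
  almost everywhere, so that each \<open>q c\<close> can serve as a Bernoulli parameter.\<close>

lemma cprob_factors:
  assumes [measurable]: "E \<in> events"
  obtains q :: "'c \<Rightarrow> real" where "q \<in> borel_measurable N" "\<And>c. 0 \<le> q c" "\<And>c. q c \<le> 1"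
    "AE \<omega> in M. cprob E \<omega> = q (Z \<omega>)"
proof -
  \<comment> \<open>\<open>?Q\<close> is the image under \<open>Z\<close> of \<open>M\<close>
    restricted to \<open>E\<close>; it is dominated by the law \<open>?P\<close>.\<close>
  let ?P = "distr M N Z" and ?Q = "distr (density M (indicator E)) N Z"
  interpret P: prob_space ?P by (rule prob_space_distr) simp
  have Q: "emeasure ?Q B = emeasure M {\<omega> \<in> E. Z \<omega> \<in> B}" if [measurable]: "B \<in> sets N" for B
  proof -
    have "emeasure ?Q B = (\<integral>\<^sup>+\<omega>. indicator E \<omega> * indicator (Z -` B \<inter> space M) \<omega> \<partial>M)"
      by (subst emeasure_distr) (auto simp: emeasure_density)
    also have "\<dots> = (\<integral>\<^sup>+\<omega>. indicator {\<omega> \<in> E. Z \<omega> \<in> B} \<omega> \<partial>M)"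
      using sets.sets_into_space[OF assms] by (intro nn_integral_cong) (auto simp: indicator_def)
    finally show ?thesis by simp
  qed
  have fin: "finite_measure ?Q"
    by (intro finite_measureI) (simp add: Q)
  have ac: "absolutely_continuous ?P ?Q"
    unfolding absolutely_continuous_def
  proof
    fix B assume "B \<in> null_sets ?P"
    then have [measurable]: "B \<in> sets N" and "emeasure M (Z -` B \<inter> space M) = 0"
      by (auto simp: null_sets_def emeasure_distr)
    moreover have "emeasure M {\<omega> \<in> E. Z \<omega> \<in> B} \<le> emeasure M (Z -` B \<inter> space M)"
      using sets.sets_into_space[OF assms] by (intro emeasure_mono) auto
    ultimately show "B \<in> null_sets ?Q"
      by (auto simp: null_sets_def Q)
  qed
  have sets_eq: "sets ?Q = sets ?P" by simp
  obtain D where D: "D \<in> borel_measurable ?P"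
    and D_eq: "AE c in ?P. RN_deriv ?P ?Q c = ennreal (D c)" and "AE c in ?Q. 0 < D c" and D0: "\<And>c. 0 \<le> D c"
    by (rule P.real_RN_deriv[OF fin ac sets_eq]) blast
  have [measurable]: "D \<in> borel_measurable N" using D by simp
  have dens: "density ?P (\<lambda>c. ennreal (D c)) = ?Q"
    using P.density_RN_deriv[OF ac] D_eq by (subst density_cong[of _ _ "RN_deriv ?P ?Q"]) auto
  interpret Q: finite_measure ?Q by (rule fin)
  have int: "integrable ?P D"
    using Q.integrable_const[of "1::real"] D0 unfolding dens[symmetric]
    by (subst (asm) integrable_density) auto
  have "prob {\<omega> \<in> E. Z \<omega> \<in> B} = (LINT c:B|?P. D c)" if [measurable]: "B \<in> sets N" for B
  proof -
    have "prob {\<omega> \<in> E. Z \<omega> \<in> B} = (LINT c|?Q. indicator B c)"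
      using sets.sets_into_space[OF that] by (simp add: Q measure_def Int_absorb2)
    also have "\<dots> = (LINT c:B|?P. D c)"
      unfolding dens[symmetric] set_lebesgue_integral_def using D0
      by (subst integral_density) (auto simp: mult.commute)
    finally show ?thesis .
  qed
  then have "AE \<omega> in M. cprob E \<omega> = D (Z \<omega>)"
    by (subst cprob_eq_comp_iff) (use int in auto)
  \<comment> \<open>Conditional probabilities lie in the unit interval almost everywhere, so
    truncating the derivative keeps it a version and forces the bounds everywhere.\<close>
  then have "AE \<omega> in M. cprob E \<omega> = max 0 (min 1 (D (Z \<omega>)))"
    using cprob_nonneg[OF assms] cprob_le_1[OF assms] by eventually_elim auto
  then show thesis
    by (intro that[of "\<lambda>c. max 0 (min 1 (D c))"]) auto
qed

section \<open>Adjoining the conditioning variable to a conditionally independent family\<close>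

text \<open>
  The \<open>H\<close> with \<open>\<integral>\<^bsub>{(Z, Y) \<in> H}\<^esub> 1\<^sub>W = \<integral>\<^bsub>{(Z, Y) \<in> H}\<^esub> P(W | Z)\<close> form a Dynkin system.
  Working with integrals here avoids pointwise limits of conditional expectations.
\<close>

lemma cond_indep_joint:
  assumes Y [measurable]: "Y \<in> measurable M V" and W [measurable]: "W \<in> events"
    and H: "H \<in> sets (N \<Otimes>\<^sub>M V)"
    and indep: "\<And>B. B \<in> sets V \<Longrightarrow> AE \<omega> in M.
      cprob ({\<omega> \<in> space M. Y \<omega> \<in> B} \<inter> W) \<omega> = cprob {\<omega> \<in> space M. Y \<omega> \<in> B} \<omega> * cprob W \<omega>"
  shows "AE \<omega> in M. cprob ({\<omega> \<in> space M. (Z \<omega>, Y \<omega>) \<in> H} \<inter> W) \<omega> =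
    cprob {\<omega> \<in> space M. (Z \<omega>, Y \<omega>) \<in> H} \<omega> * cprob W \<omega>"
proof -
  define T where "T H = {\<omega> \<in> space M. (Z \<omega>, Y \<omega>) \<in> H}" for H
  have T [measurable]: "T H \<in> events" if [measurable]: "H \<in> sets (N \<Otimes>\<^sub>M V)" for H
    unfolding T_def by measurable
  have int_w: "integrable M (cprob W)"
    by (intro real_cond_exp_int) simp
  have int_Tw: "integrable M (\<lambda>\<omega>. indicator A \<omega> * cprob W \<omega>)" if "A \<in> events" for A
    using integrable_mult_indicator[OF that int_w] by simp
  have key: "(LINT \<omega>:T H|M. indicator W \<omega>) = (LINT \<omega>:T H|M. cprob W \<omega>)"
    if "H \<in> sets (N \<Otimes>\<^sub>M V)" for H
    using Int_stable_pair_measure_generator pair_measure_closed that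
    unfolding sets_pair_measure
  proof (induction rule: sigma_sets_induct_disjoint)
    case (basic H)
    then obtain a b where H: "H = a \<times> b" and [measurable]: "a \<in> sets N" "b \<in> sets V" by auto
    define G where "G = Z -` a \<inter> space M"
    let ?B = "{\<omega> \<in> space M. Y \<omega> \<in> b}"
    have B [measurable]: "?B \<in> events" by measurable
    have [measurable]: "G \<in> sets F" unfolding G_def by (rule vimage_in_F) simp
    then have [measurable]: "G \<in> events" by (rule sets_F_D)
    have "(LINT \<omega>:T H|M. indicator W \<omega>) = (LINT \<omega>:G|M. indicator (?B \<inter> W) \<omega> :: real)"
      unfolding set_lebesgue_integral_def
      by (intro Bochner_Integration.integral_cong) (auto simp: T_def G_def H indicator_def)
    also have "\<dots> = (LINT \<omega>:G|M. cprob (?B \<inter> W) \<omega>)"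
      by (intro real_cond_exp_intA) auto
    also have "\<dots> = (LINT \<omega>:G|M. cprob ?B \<omega> * cprob W \<omega>)"
      using indep[of b] by (intro set_lebesgue_integral_cong_AE) auto
    also have "\<dots> = (LINT \<omega>|M. (indicator G \<omega> * cprob W \<omega>) * cprob ?B \<omega>)"
      by (simp add: set_lebesgue_integral_def ac_simps)
    \<comment> \<open>The weight \<open>indicator G * cprob W\<close> is measurable with respect to
      \<open>F\<close>, so under the integral \<open>cprob ?B\<close> can be exchanged for
      \<open>indicator ?B\<close>; together with \<open>G\<close> this rebuilds the event
      \<open>T H\<close>.\<close>
    also have "\<dots> = (LINT \<omega>|M. (indicator G \<omega> * cprob W \<omega>) * indicator ?B \<omega>)"
    proof (rule real_cond_exp_intg)
      show "integrable M (\<lambda>\<omega>. (indicator G \<omega> * cprob W \<omega>) * indicator ?B \<omega>)"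
        using int_Tw[OF sets.Int[OF \<open>G \<in> events\<close> B]] by (simp add: indicator_inter_arith ac_simps)
    qed measurable
    also have "\<dots> = (LINT \<omega>:T H|M. cprob W \<omega>)"
      unfolding set_lebesgue_integral_def
      by (intro Bochner_Integration.integral_cong) (auto simp: T_def G_def H indicator_def)
    finally show ?case .
  next
    case empty
    show ?case by (simp add: T_def set_lebesgue_integral_def)
  next
    case (compl H)
    have [measurable]: "T H \<in> events"
      using compl.hyps by (intro T) (simp add: sets_pair_measure)
    \<comment> \<open>To be used for both integrands, \<open>indicator W\<close> and
      \<open>cprob W\<close>, whose integrals over the whole space agree.\<close>
    have split: "(LINT \<omega>:T (space N \<times> space V - H)|M. f \<omega>) = (LINT \<omega>|M. f \<omega>) - (LINT \<omega>:T H|M. f \<omega>)"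
      if f: "integrable M f" for f :: "'w \<Rightarrow> real"
    proof -
      have "(LINT \<omega>:T (space N \<times> space V - H)|M. f \<omega>) = (LINT \<omega>|M. f \<omega> - indicator (T H) \<omega> * f \<omega>)"
        unfolding set_lebesgue_integral_def
        by (intro Bochner_Integration.integral_cong)
           (auto simp: T_def indicator_def measurable_space[OF Z] measurable_space[OF Y])
      then show ?thesis
        using f integrable_mult_indicator[OF \<open>T H \<in> events\<close> f]
        by (simp add: set_lebesgue_integral_def)
    qed
    show ?case
      using compl.IH real_cond_exp_int(2)[of "indicator W"] int_w by (simp add: split)
  next
    case (union H)
    have [measurable]: "T (H i) \<in> events" for i
      using union.hyps by (intro T) (auto simp: sets_pair_measure)
    have UN: "T (\<Union>i. H i) = (\<Union>i. T (H i))" by (auto simp: T_def)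
    have split: "(LINT \<omega>:T (\<Union>i. H i)|M. f \<omega>) = (\<Sum>i. LINT \<omega>:T (H i)|M. f \<omega>)"
      if f: "integrable M f" for f :: "'w \<Rightarrow> real"
      unfolding UN
    proof (rule lebesgue_integral_countable_add)
      show "T (H i) \<inter> T (H j) = {}" if "i \<noteq> j" for i j
        using union.hyps(1) that by (auto simp: T_def disjoint_family_on_def)
      have "(\<Union>i. T (H i)) \<in> events" by measurable
      from integrable_mult_indicator[OF this f]
      show "set_integrable M (\<Union>i. T (H i)) f" by (simp add: set_integrable_def)
    qed measurable
    show ?case using union.IH int_w by (simp add: split)
  qed
  have "AE \<omega> in M. cprob (T H \<inter> W) \<omega> = cprob (T H) \<omega> * cprob W \<omega>"
  proof (rule real_cond_exp_charact)
    have T_H [measurable]: "T H \<in> events" using H by simp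
    \<comment> \<open>The same exchange for general \<open>H\<close>: the factor
      \<open>indicator A * cprob W\<close> is \<open>F\<close>-measurable, so \<open>T H\<close> may
      be replaced by its conditional probability under the integral.\<close>
    have int: "integrable M (\<lambda>\<omega>. (indicator A \<omega> * cprob W \<omega>) * cprob (T H) \<omega>)"
      "(LINT \<omega>|M. (indicator A \<omega> * cprob W \<omega>) * cprob (T H) \<omega>) =
       (LINT \<omega>|M. (indicator A \<omega> * cprob W \<omega>) * indicator (T H) \<omega>)" if A [measurable]: "A \<in> sets F" for A
    proof -
      have "A \<in> events" using A by (rule sets_F_D)
      then have "integrable M (\<lambda>\<omega>. (indicator A \<omega> * cprob W \<omega>) * indicator (T H) \<omega>)"
        using int_Tw[of "A \<inter> T H"] by (auto simp: indicator_inter_arith ac_simps)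
      then show "integrable M (\<lambda>\<omega>. (indicator A \<omega> * cprob W \<omega>) * cprob (T H) \<omega>)"
        "(LINT \<omega>|M. (indicator A \<omega> * cprob W \<omega>) * cprob (T H) \<omega>) =
         (LINT \<omega>|M. (indicator A \<omega> * cprob W \<omega>) * indicator (T H) \<omega>)"
        by (intro real_cond_exp_intg; auto)+
    qed
    show "integrable M (\<lambda>\<omega>. cprob (T H) \<omega> * cprob W \<omega>)"
      using int(1)[of "space M"] sets.top[of F]
      by (simp add: mult.commute cong: Bochner_Integration.integrable_cong)
    show "integrable M (indicator (T H \<inter> W) :: _ \<Rightarrow> real)" by auto
    fix A assume A: "A \<in> sets F"
    then obtain B where [measurable]: "B \<in> sets N" and A_eq: "A = Z -` B \<inter> space M"
      unfolding sets_F by auto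
    \<comment> \<open>The event \<open>A\<close> is itself a condition on \<open>Z\<close>.
      Intersecting with it stays within events about \<open>(Z, Y)\<close>, so \<open>key\<close>
      covers all the integrals that characterize the conditional expectation.\<close>
    let ?H = "H \<inter> B \<times> space V"
    have TA: "T ?H = A \<inter> T H"
      by (auto simp: T_def A_eq measurable_space[OF Y])
    have "(LINT \<omega>:A|M. indicator (T H \<inter> W) \<omega> :: real) = (LINT \<omega>:T ?H|M. indicator W \<omega>)"
      by (simp add: TA set_lebesgue_integral_def indicator_inter_arith ac_simps)
    also have "\<dots> = (LINT \<omega>:T ?H|M. cprob W \<omega>)"
      using H by (intro key) auto
    also have "\<dots> = (LINT \<omega>|M. (indicator A \<omega> * cprob W \<omega>) * indicator (T H) \<omega>)"
      by (simp add: TA set_lebesgue_integral_def indicator_inter_arith ac_simps)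
    also have "\<dots> = (LINT \<omega>:A|M. cprob (T H) \<omega> * cprob W \<omega>)"
      by (subst int(2)[symmetric, OF A]) (simp add: set_lebesgue_integral_def ac_simps)
    finally show "(LINT \<omega>:A|M. indicator (T H \<inter> W) \<omega>) = (LINT \<omega>:A|M. cprob (T H) \<omega> * cprob W \<omega>)" .
  qed auto
  then show ?thesis unfolding T_def .
qed

text \<open>Given \<open>Z\<close>, the first coordinate of each pair is known, so adjoining it
  brings no new dependence. This is what allows treatments to depend on the controls as well as on
  the private unobservable.\<close>

lemma cond_indep_vars_joint:
  assumes indep: "cond_indep_vars M F S Y I"
  shows "cond_indep_vars M F (\<lambda>j. N \<Otimes>\<^sub>M S j) (\<lambda>j \<omega>. (Z \<omega>, Y j \<omega>)) I"
proof -
  have Y: "Y i \<in> measurable M (S i)" if "i \<in> I" for i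
    using indep that by (simp add: cond_indep_vars_def)
  let ?E = "\<lambda>j H. {\<omega> \<in> space M. (Z \<omega>, Y j \<omega>) \<in> H}"
  \<comment> \<open>\<open>K\<close> collects the indices at which \<open>H j\<close> may be
    arbitrary; at the others it is \<open>space N \<times> B\<close>, an event about
    \<open>Y j\<close> alone. The case \<open>K = {}\<close> is the hypothesis, and
    \<open>K = J\<close> is the goal. \<open>J\<close> stays fixed in the induction while
    \<open>H\<close> varies.\<close>
  have main: "AE \<omega> in M. cprob {\<omega> \<in> space M. \<forall>j\<in>J. (Z \<omega>, Y j \<omega>) \<in> H j} \<omega> = (\<Prod>j\<in>J. cprob (?E j (H j)) \<omega>)"
    if J: "J \<subseteq> I" "finite J" "J \<noteq> {}" and "finite K" and "\<And>j. j \<in> J \<Longrightarrow> H j \<in> sets (N \<Otimes>\<^sub>M S j)"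
      and "\<And>j. j \<in> J - K \<Longrightarrow> \<exists>B\<in>sets (S j). H j = space N \<times> B" for J H K
    using \<open>finite K\<close> that(5,6)
  proof (induction K arbitrary: H rule: finite_induct)
    case empty
    then have "\<forall>j\<in>J. \<exists>B. B \<in> sets (S j) \<and> H j = space N \<times> B" by blast
    then obtain B where B: "\<And>j. j \<in> J \<Longrightarrow> B j \<in> sets (S j)" "\<And>j. j \<in> J \<Longrightarrow> H j = space N \<times> B j"
      by metis
    have "?E j (H j) = {\<omega> \<in> space M. Y j \<omega> \<in> B j}" if "j \<in> J" for j
      using B(2)[OF that] measurable_space[OF Z] by auto
    moreover have "{\<omega> \<in> space M. \<forall>j\<in>J. (Z \<omega>, Y j \<omega>) \<in> H j} = {\<omega> \<in> space M. \<forall>j\<in>J. Y j \<omega> \<in> B j}"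
      using B(2) measurable_space[OF Z] by auto
    ultimately show ?case
      using indep B(1) J by (simp add: cond_indep_vars_def)
  next
    case (insert k K)
    show ?case
    proof (cases "k \<in> J")
      case False
      then show ?thesis using insert.prems by (intro insert.IH) auto
    next
      case True
      define W where "W = {\<omega> \<in> space M. \<forall>j\<in>J - {k}. (Z \<omega>, Y j \<omega>) \<in> H j}"
      define R where "R \<omega> = (\<Prod>j\<in>J - {k}. cprob (?E j (H j)) \<omega>)" for \<omega>
      have k: "k \<in> I" using True J by auto
      note [measurable] = Y[OF k]
      have E: "?E j (H j) \<in> events" if "j \<in> J" for j
      proof -
        have [measurable]: "Y j \<in> measurable M (S j)" "H j \<in> sets (N \<Otimes>\<^sub>M S j)"
          using that J Y insert.prems by auto
        show ?thesis by measurable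
      qed
      have W [measurable]: "W \<in> events"
        unfolding W_def using E J by (intro sets.sets_Collect_finite_All) auto
      \<comment> \<open>Overwriting \<open>H k\<close> with \<open>space N \<times> B\<close> meets
        the restriction at \<open>k\<close>, so the induction hypothesis for \<open>K\<close>
        applies. It yields the factorization for every \<open>B\<close>, from which
        \<open>cond_indep_joint\<close> passes to the original \<open>H k\<close>.\<close>
      have slice: "AE \<omega> in M. cprob ({\<omega> \<in> space M. Y k \<omega> \<in> B} \<inter> W) \<omega> =
          cprob {\<omega> \<in> space M. Y k \<omega> \<in> B} \<omega> * R \<omega>" if B: "B \<in> sets (S k)" for B
      proof -
        let ?H = "H(k := space N \<times> B)"
        have "AE \<omega> in M. cprob {\<omega> \<in> space M. \<forall>j\<in>J. (Z \<omega>, Y j \<omega>) \<in> ?H j} \<omega> =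
            (\<Prod>j\<in>J. cprob (?E j (?H j)) \<omega>)"
          using insert.prems B by (intro insert.IH) auto
        moreover have "?E k (?H k) = {\<omega> \<in> space M. Y k \<omega> \<in> B}"
          using measurable_space[OF Z] by auto
        moreover have "{\<omega> \<in> space M. \<forall>j\<in>J. (Z \<omega>, Y j \<omega>) \<in> ?H j} = {\<omega> \<in> space M. Y k \<omega> \<in> B} \<inter> W"
          using True measurable_space[OF Z] by (auto simp: W_def split: if_splits)
        ultimately show ?thesis
          using True J by (simp add: prod.remove[of J k] R_def)
      qed
      \<comment> \<open>Taking \<open>B\<close> to be the whole space removes index \<open>k\<close>
        from the product. This also covers \<open>J = {k}\<close>, where \<open>W\<close> is the
        sample space and \<open>R\<close> is the empty product.\<close>
      have W_eq: "AE \<omega> in M. cprob W \<omega> = R \<omega>"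
      proof -
        have "{\<omega> \<in> space M. Y k \<omega> \<in> space (S k)} = space M"
          using measurable_space[OF Y[OF k]] by auto
        moreover have "space M \<inter> W = W" by (auto simp: W_def)
        ultimately show ?thesis
          using slice[OF sets.top] cprob_space by auto
      qed
      have "AE \<omega> in M. cprob (?E k (H k) \<inter> W) \<omega> = cprob (?E k (H k)) \<omega> * cprob W \<omega>"
      proof (rule cond_indep_joint)
        show "AE \<omega> in M. cprob ({\<omega> \<in> space M. Y k \<omega> \<in> B} \<inter> W) \<omega> =
          cprob {\<omega> \<in> space M. Y k \<omega> \<in> B} \<omega> * cprob W \<omega>" if "B \<in> sets (S k)" for B
          using slice[OF that] W_eq by eventually_elim simp
      qed (use True insert.prems in auto)
      moreover have "?E k (H k) \<inter> W = {\<omega> \<in> space M. \<forall>j\<in>J. (Z \<omega>, Y j \<omega>) \<in> H j}"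
        using True by (auto simp: W_def)
      moreover have "(\<Prod>j\<in>J. cprob (?E j (H j)) \<omega>) = cprob (?E k (H k)) \<omega> * R \<omega>" for \<omega>
        using True J by (simp add: prod.remove[of J k] R_def)
      ultimately show ?thesis
        using W_eq by auto
    qed
  qed
  show ?thesis
    unfolding cond_indep_vars_def
  proof (intro conjI ballI allI impI)
    show "(\<lambda>\<omega>. (Z \<omega>, Y i \<omega>)) \<in> measurable M (N \<Otimes>\<^sub>M S i)" if "i \<in> I" for i
      using Y[OF that] by measurable
    next
    fix J H assume J: "J \<subseteq> I" "finite J" "J \<noteq> {}" and H: "\<forall>j\<in>J. H j \<in> sets (N \<Otimes>\<^sub>M S j)"
    then show "AE \<omega> in M. cprob {\<omega> \<in> space M. \<forall>j\<in>J. (Z \<omega>, Y j \<omega>) \<in> H j} \<omega> =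
      (\<Prod>j\<in>J. cprob (?E j (H j)) \<omega>)"
      by (intro main[of J J]) auto
  qed
qed

section \<open>Conditional mass functions as conditional probabilities\<close>

text \<open>For each value \<open>y\<close> this is \<open>cprob_eq_comp_iff\<close> for the event
  \<open>Y = y\<close>; integrability holds because a mass function is bounded by 1.\<close>

lemma is_cond_pmf_iff:
  assumes Y: "\<And>y. {\<omega> \<in> space M. Y \<omega> = y} \<in> events"
  shows "is_cond_pmf M N Z Y p \<longleftrightarrow> (\<forall>y. (\<lambda>c. pmf (p c) y) \<in> borel_measurable N \<and>
    (AE \<omega> in M. cprob {\<omega> \<in> space M. Y \<omega> = y} \<omega> = pmf (p (Z \<omega>)) y))"
proof -
  interpret P: prob_space "distr M N Z" by (rule prob_space_distr) simp
  have int: "integrable (distr M N Z) (\<lambda>c. pmf (p c) y)"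
    if [measurable]: "(\<lambda>c. pmf (p c) y) \<in> borel_measurable N" for y
    by (intro P.integrable_const_bound[where B = 1]) (auto simp: pmf_le_1)
  have set_eq: "{\<omega> \<in> space M. Y \<omega> = y \<and> Z \<omega> \<in> B} = {\<omega> \<in> {\<omega> \<in> space M. Y \<omega> = y}. Z \<omega> \<in> B}" for y B
    by auto
  show ?thesis
    unfolding is_cond_pmf_def set_eq using cprob_eq_comp_iff[OF Y _ int] by blast
qed

end

section \<open>Stability of conditional independence and conditional mass functions\<close>

text \<open>An event about \<open>g i (Y i)\<close> is an event about \<open>Y i\<close>, with the
  preimage under \<open>g i\<close> as its set. The preimage is cut down to
  \<open>space (S i)\<close>, where measurability of \<open>g i\<close> applies and where
  \<open>Y i\<close> takes its values.\<close>

lemma cond_indep_vars_compose: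
  assumes indep: "cond_indep_vars M F S Y I" and g: "\<And>i. i \<in> I \<Longrightarrow> g i \<in> measurable (S i) (T i)"
  shows "cond_indep_vars M F T (\<lambda>i \<omega>. g i (Y i \<omega>)) I"
  unfolding cond_indep_vars_def
proof (intro conjI ballI allI impI)
  have Y: "Y i \<in> measurable M (S i)" if "i \<in> I" for i
    using indep that by (simp add: cond_indep_vars_def)
  show "(\<lambda>\<omega>. g i (Y i \<omega>)) \<in> measurable M (T i)" if "i \<in> I" for i
    using measurable_compose[OF Y g] that by simp
  fix J B assume J: "J \<subseteq> I" "finite J" "J \<noteq> {}" and B: "\<forall>j\<in>J. B j \<in> sets (T j)"
  let ?B = "\<lambda>j. g j -` B j \<inter> space (S j)"
  have B': "\<forall>j\<in>J. ?B j \<in> sets (S j)"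
    using g B J by (auto intro!: measurable_sets)
  have iff: "g j (Y j \<omega>) \<in> B j \<longleftrightarrow> Y j \<omega> \<in> ?B j" if "j \<in> J" "\<omega> \<in> space M" for j \<omega>
    using measurable_space[OF Y] that J by auto
  have all: "{\<omega> \<in> space M. \<forall>j\<in>J. g j (Y j \<omega>) \<in> B j} = {\<omega> \<in> space M. \<forall>j\<in>J. Y j \<omega> \<in> ?B j}"
    by (intro Collect_cong conj_cong ball_cong refl iff)
  have single: "(\<Prod>j\<in>J. real_cond_exp M F (indicator {\<omega> \<in> space M. g j (Y j \<omega>) \<in> B j}) \<omega>) =
      (\<Prod>j\<in>J. real_cond_exp M F (indicator {\<omega> \<in> space M. Y j \<omega> \<in> ?B j}) \<omega>)" for \<omega>
    by (intro prod.cong refl arg_cong[where f = "\<lambda>E. real_cond_exp M F (indicator E) \<omega>"]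
        Collect_cong conj_cong iff)
  show "AE \<omega> in M.
      real_cond_exp M F (indicator {\<omega> \<in> space M. \<forall>j\<in>J. g j (Y j \<omega>) \<in> B j}) \<omega> =
      (\<Prod>j\<in>J. real_cond_exp M F (indicator {\<omega> \<in> space M. g j (Y j \<omega>) \<in> B j}) \<omega>)"
    unfolding all single
    using indep[unfolded cond_indep_vars_def, THEN conjunct2, rule_format, of J ?B] J B' by blast
qed

text \<open>Conditional independence sees the family only through events inside
  \<open>space M\<close>. The treatment equation is likewise given only there.\<close>

lemma cond_indep_vars_cong:
  assumes "\<And>i \<omega>. i \<in> I \<Longrightarrow> \<omega> \<in> space M \<Longrightarrow> Y i \<omega> = Y' i \<omega>"
    and indep: "cond_indep_vars M F S Y' I"
  shows "cond_indep_vars M F S Y I"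
  unfolding cond_indep_vars_def
proof (intro conjI ballI allI impI)
  show "Y i \<in> measurable M (S i)" if "i \<in> I" for i
    using indep that assms(1)[OF that] by (subst measurable_cong[of _ _ "Y' i"]) (auto simp: cond_indep_vars_def)
  fix J B assume J: "J \<subseteq> I" "finite J" "J \<noteq> {}" and B: "\<forall>j\<in>J. B j \<in> sets (S j)"
  have iff: "Y j \<omega> \<in> B j \<longleftrightarrow> Y' j \<omega> \<in> B j" if "j \<in> J" "\<omega> \<in> space M" for j \<omega>
    using assms(1)[OF subsetD[OF J(1) that(1)] that(2)] by simp
  have all: "{\<omega> \<in> space M. \<forall>j\<in>J. Y j \<omega> \<in> B j} = {\<omega> \<in> space M. \<forall>j\<in>J. Y' j \<omega> \<in> B j}"
    by (intro Collect_cong conj_cong ball_cong refl iff)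
  have single: "(\<Prod>j\<in>J. real_cond_exp M F (indicator {\<omega> \<in> space M. Y j \<omega> \<in> B j}) \<omega>) =
      (\<Prod>j\<in>J. real_cond_exp M F (indicator {\<omega> \<in> space M. Y' j \<omega> \<in> B j}) \<omega>)" for \<omega>
    by (intro prod.cong refl arg_cong[where f = "\<lambda>E. real_cond_exp M F (indicator E) \<omega>"]
        Collect_cong conj_cong iff)
  show "AE \<omega> in M.
      real_cond_exp M F (indicator {\<omega> \<in> space M. \<forall>j\<in>J. Y j \<omega> \<in> B j}) \<omega> =
      (\<Prod>j\<in>J. real_cond_exp M F (indicator {\<omega> \<in> space M. Y j \<omega> \<in> B j}) \<omega>)"
    unfolding all single
    using indep[unfolded cond_indep_vars_def, THEN conjunct2, rule_format, of J B] J B by blast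
qed

lemma is_cond_pmf_cong:
  assumes "\<And>\<omega>. \<omega> \<in> space M \<Longrightarrow> C \<omega> = C' \<omega>"
  shows "is_cond_pmf M N C Y p \<longleftrightarrow> is_cond_pmf M N C' Y p"
proof -
  have "distr M N C = distr M N C'"
    using assms by (intro distr_cong) auto
  moreover have "{\<omega> \<in> space M. Y \<omega> = y \<and> C \<omega> \<in> B} = {\<omega> \<in> space M. Y \<omega> = y \<and> C' \<omega> \<in> B}" for y B
    using assms by auto
  ultimately show ?thesis by (simp add: is_cond_pmf_def)
qed

section \<open>The MTP2 inequality for product functions\<close>

lemma MTP2_on_subset: "MTP2_on E f \<Longrightarrow> E' \<subseteq> E \<Longrightarrow> MTP2_on E' f"
  unfolding MTP2_on_def by blast

text \<open>In each coordinate, minimum and maximum return the same two arguments, possibly swapped,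
  so the inequality is an equality factor by factor.\<close>

lemma MTP2_on_prod:
  fixes f :: "('n::finite \<Rightarrow> nat) \<Rightarrow> real"
  assumes "\<And>d. f d = (\<Prod>j\<in>UNIV. g j (d j))"
  shows "MTP2_on E f"
proof -
  have "g j (min a b) * g j (max a b) = g j a * g j b" for j a b
    by (simp add: min_def max_def)
  then show ?thesis
    by (simp add: MTP2_on_def assms flip: prod.distrib)
qed

section \<open>The conditional law of a conditionally independent family\<close>

context conditioning
begin

text \<open>The index type is finite, so \<open>D = d\<close> is a finite intersection of the events
  \<open>D j \<in> {d j}\<close>, and conditional independence applies to these singletons.\<close>

lemma
  fixes D :: "'n::finite \<Rightarrow> 'w \<Rightarrow> nat"
  assumes indep: "cond_indep_vars M F (\<lambda>_. count_space UNIV) D UNIV"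
  shows event_indep_eq: "{\<omega> \<in> space M. (\<lambda>j. D j \<omega>) = d} \<in> events"
    and cprob_indep_eq: "AE \<omega> in M. cprob {\<omega> \<in> space M. (\<lambda>j. D j \<omega>) = d} \<omega> =
      (\<Prod>j\<in>UNIV. cprob {\<omega> \<in> space M. D j \<omega> = d j} \<omega>)"
proof -
  have eq: "{\<omega> \<in> space M. (\<lambda>j. D j \<omega>) = d} = {\<omega> \<in> space M. \<forall>j\<in>UNIV. D j \<omega> \<in> {d j}}"
    by auto
  have D: "D j \<in> measurable M (count_space UNIV)" for j
    using indep by (simp add: cond_indep_vars_def)
  have "{\<omega> \<in> space M. D j \<omega> \<in> {d j}} \<in> events" for j
    using measurable_sets[OF D, of "{d j}" j] by (simp add: vimage_def Int_def conj_commute)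
  then show "{\<omega> \<in> space M. (\<lambda>j. D j \<omega>) = d} \<in> events"
    unfolding eq by (intro sets.sets_Collect_finite_All) auto
  have "AE \<omega> in M. cprob {\<omega> \<in> space M. \<forall>j\<in>UNIV. D j \<omega> \<in> {d j}} \<omega> =
      (\<Prod>j\<in>UNIV. cprob {\<omega> \<in> space M. D j \<omega> \<in> {d j}} \<omega>)"
    using indep[unfolded cond_indep_vars_def, THEN conjunct2, rule_format, of UNIV "\<lambda>j. {d j}"] by simp
  then show "AE \<omega> in M. cprob {\<omega> \<in> space M. (\<lambda>j. D j \<omega>) = d} \<omega> =
      (\<Prod>j\<in>UNIV. cprob {\<omega> \<in> space M. D j \<omega> = d j} \<omega>)"
    unfolding eq by simp
qed

text \<open>An arbitrary version agrees with the product of the coordinate probabilities only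
  outside a null set, hence the almost-everywhere conclusion.\<close>

lemma AE_MTP2_cond_pmf:
  fixes D :: "'n::finite \<Rightarrow> 'w \<Rightarrow> nat"
  assumes indep: "cond_indep_vars M F (\<lambda>_. count_space UNIV) D UNIV"
    and p: "is_cond_pmf M N Z (\<lambda>\<omega> j. D j \<omega>) p"
  shows "AE c in distr M N Z. MTP2_on E (pmf (p c))"
proof -
  have [measurable]: "(\<lambda>c. pmf (p c) d) \<in> borel_measurable N" for d
    using p by (simp add: is_cond_pmf_def)
  have "AE \<omega> in M. pmf (p (Z \<omega>)) d = (\<Prod>j\<in>UNIV. cprob {\<omega> \<in> space M. D j \<omega> = d j} \<omega>)" for d
  proof -
    have "AE \<omega> in M. cprob {\<omega> \<in> space M. (\<lambda>j. D j \<omega>) = d} \<omega> = pmf (p (Z \<omega>)) d"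
      using p by (subst (asm) is_cond_pmf_iff) (auto simp: event_indep_eq[OF indep])
    then show ?thesis
      using cprob_indep_eq[OF indep, of d] by eventually_elim simp
  qed
  \<comment> \<open>With a finite index type there are only countably many vectors \<open>d\<close>,
    so their exceptional null sets merge into one.\<close>
  then have "AE \<omega> in M. \<forall>d. pmf (p (Z \<omega>)) d = (\<Prod>j\<in>UNIV. cprob {\<omega> \<in> space M. D j \<omega> = d j} \<omega>)"
    by (simp add: AE_all_countable)
  then have "AE \<omega> in M. MTP2_on UNIV (pmf (p (Z \<omega>)))"
  proof eventually_elim
    case (elim \<omega>)
    then show ?case by (intro MTP2_on_prod[where g = "\<lambda>j n. cprob {\<omega> \<in> space M. D j \<omega> = n} \<omega>"]) simp
  qed
  \<comment> \<open>Countability again gives measurability of this set, which is needed to carry the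
    statement from \<open>M\<close> to the law of \<open>Z\<close>.\<close>
  moreover have "{c \<in> space N. MTP2_on UNIV (pmf (p c))} \<in> sets N"
    unfolding MTP2_on_def by measurable
  ultimately have "AE c in distr M N Z. MTP2_on UNIV (pmf (p c))"
    by (subst AE_distr_iff) auto
  then show ?thesis
    by eventually_elim (erule MTP2_on_subset, simp)
qed

text \<open>The version is built from scratch as a product of Bernoulli laws, so that the
  factorization, and with it the inequality, holds at every point \<open>c\<close>.\<close>

lemma ex_MTP2_cond_pmf:
  fixes D :: "'n::finite \<Rightarrow> 'w \<Rightarrow> nat"
  assumes indep: "cond_indep_vars M F (\<lambda>_. count_space UNIV) D UNIV"
    and binary: "\<And>j \<omega>. \<omega> \<in> space M \<Longrightarrow> D j \<omega> \<in> {0, 1}"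
  obtains p where "is_cond_pmf M N Z (\<lambda>\<omega> j. D j \<omega>) p" "\<And>c E. MTP2_on E (pmf (p c))"
proof -
  have D: "D j \<in> measurable M (count_space UNIV)" for j
    using indep by (simp add: cond_indep_vars_def)
  have D1 [measurable]: "{\<omega> \<in> space M. D j \<omega> = 1} \<in> events" for j
    using measurable_sets[OF D, of "{1}" j] by (simp add: vimage_def Int_def conj_commute)
  have "\<exists>q. q \<in> borel_measurable N \<and> (\<forall>c. 0 \<le> q c) \<and> (\<forall>c. q c \<le> 1) \<and>
      (AE \<omega> in M. cprob {\<omega> \<in> space M. D j \<omega> = 1} \<omega> = q (Z \<omega>))" for j
    by (rule cprob_factors[OF D1[of j]]) blast
  then have "\<exists>q. \<forall>j. q j \<in> borel_measurable N \<and> (\<forall>c. 0 \<le> q j c) \<and> (\<forall>c. q j c \<le> 1) \<and>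
      (AE \<omega> in M. cprob {\<omega> \<in> space M. D j \<omega> = 1} \<omega> = q j (Z \<omega>))"
    by (intro choice allI)
  then obtain q where q_spec: "\<forall>j. q j \<in> borel_measurable N \<and> (\<forall>c. 0 \<le> q j c) \<and>
      (\<forall>c. q j c \<le> 1) \<and> (AE \<omega> in M. cprob {\<omega> \<in> space M. D j \<omega> = 1} \<omega> = q j (Z \<omega>))" ..
  then have [measurable]: "q j \<in> borel_measurable N" and q01: "0 \<le> q j c" "q j c \<le> 1"
    and q: "AE \<omega> in M. cprob {\<omega> \<in> space M. D j \<omega> = 1} \<omega> = q j (Z \<omega>)" for j c
    by blast+
  \<comment> \<open>\<open>r j c\<close> is the mass function on the naturals of the Bernoulli law
    with parameter \<open>q j c\<close>; the product law \<open>p c\<close> has these as its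
    factors.\<close>
  define r where "r j c n = (if n = 1 then q j c else if n = 0 then 1 - q j c else 0)" for j c and n :: nat
  define p where "p c = Pi_pmf UNIV 0 (\<lambda>j. map_pmf (of_bool :: bool \<Rightarrow> nat) (bernoulli_pmf (q j c)))" for c
  have "pmf (map_pmf (of_bool :: bool \<Rightarrow> nat) (bernoulli_pmf (q j c))) n = r j c n" for j c n
  proof -
    have "(of_bool :: bool \<Rightarrow> nat) -` {n} = (if n = 1 then {True} else if n = 0 then {False} else {})"
      by (intro set_eqI, case_tac x) auto
    then show ?thesis
      by (simp add: pmf_map r_def measure_pmf_single q01)
  qed
  then have pmf_p: "pmf (p c) d = (\<Prod>j\<in>UNIV. r j c (d j))" for c d
    by (simp add: p_def pmf_Pi)
  have r: "AE \<omega> in M. cprob {\<omega> \<in> space M. D j \<omega> = n} \<omega> = r j (Z \<omega>) n" for j n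
  proof -
    consider "n = 1" | "n = 0" | "n \<noteq> 0" "n \<noteq> 1" by blast
    then show ?thesis
    proof cases
      case 1
      then show ?thesis using q[of j] by (simp add: r_def)
    next
      case 2
      \<comment> \<open>Because \<open>D j\<close> is binary, the event \<open>D j = 0\<close> is
        the complement of \<open>D j = 1\<close>, and linearity gives the conditional probability
        \<open>1 - q j\<close>.\<close>
      have "D j \<omega> = 0 \<longleftrightarrow> D j \<omega> \<noteq> 1" if "\<omega> \<in> space M" for \<omega>
        using binary[OF that, of j] by auto
      then have compl: "{\<omega> \<in> space M. D j \<omega> = 0} = space M - {\<omega> \<in> space M. D j \<omega> = 1}"
        by blast
      have "(indicator {\<omega> \<in> space M. D j \<omega> = 0} :: _ \<Rightarrow> real) =
          (\<lambda>\<omega>. indicator (space M) \<omega> - indicator {\<omega> \<in> space M. D j \<omega> = 1} \<omega>)"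
        unfolding compl by (auto simp: indicator_def fun_eq_iff)
      moreover have "AE \<omega> in M. real_cond_exp M F
          (\<lambda>\<omega>. indicator (space M) \<omega> - indicator {\<omega> \<in> space M. D j \<omega> = 1} \<omega>) \<omega> =
          cprob (space M) \<omega> - cprob {\<omega> \<in> space M. D j \<omega> = 1} \<omega>"
        by (intro real_cond_exp_diff integrable_indicator_event sets.top D1)
      ultimately have "AE \<omega> in M. cprob {\<omega> \<in> space M. D j \<omega> = 0} \<omega> =
          cprob (space M) \<omega> - cprob {\<omega> \<in> space M. D j \<omega> = 1} \<omega>"
        by simp
      then show ?thesis
        using q[of j] cprob_space by eventually_elim (simp add: r_def 2)
    next
      case 3
      have "D j \<omega> \<noteq> n" if "\<omega> \<in> space M" for \<omega>
        using binary[OF that, of j] 3 by auto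
      then have empty: "{\<omega> \<in> space M. D j \<omega> = n} = {}" by blast
      have "AE \<omega> in M. cprob {} \<omega> = indicator {} \<omega>"
        by (intro real_cond_exp_F_meas) auto
      then show ?thesis
        unfolding empty using 3 by (simp add: r_def)
    qed
  qed
  have "is_cond_pmf M N Z (\<lambda>\<omega> j. D j \<omega>) p"
  proof (subst is_cond_pmf_iff[OF event_indep_eq[OF indep]], intro allI conjI)
    fix d
    have "(\<lambda>c. r j c (d j)) \<in> borel_measurable N" for j
      unfolding r_def by measurable
    then show "(\<lambda>c. pmf (p c) d) \<in> borel_measurable N"
      unfolding pmf_p by measurable
    have "AE \<omega> in M. \<forall>j. cprob {\<omega> \<in> space M. D j \<omega> = d j} \<omega> = r j (Z \<omega>) (d j)"
      using r by (simp add: AE_all_countable)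
    then show "AE \<omega> in M. cprob {\<omega> \<in> space M. (\<lambda>j. D j \<omega>) = d} \<omega> = pmf (p (Z \<omega>)) d"
      using cprob_indep_eq[OF indep, of d] by eventually_elim (simp add: pmf_p)
  qed
  moreover have "MTP2_on E (pmf (p c))" for c E
    by (rule MTP2_on_prod) (rule pmf_p)
  ultimately show thesis by (rule that)
qed

end

section \<open>Treatments determined by the controls and private unobservables\<close>

text \<open>Conditional mass functions are unique only up to null sets of the law of the controls.
  The inequality is therefore stated twice: almost everywhere for every version, and at all points
  of the support for a suitable version.\<close>

theorem proposition1:
  fixes M :: "'w measure"
    and V :: "'u measure"
    and X :: "'w \<Rightarrow> 'n::finite \<Rightarrow> 'x::second_countable_topology"
    and A :: "'w \<Rightarrow> real ^ 'n ^ 'n"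
    and \<nu> :: "'n \<Rightarrow> 'w \<Rightarrow> 'u"
    and h :: "'n \<Rightarrow> ('n \<Rightarrow> 'x) \<Rightarrow> real ^ 'n ^ 'n \<Rightarrow> 'u \<Rightarrow> nat"
    and D :: "'n \<Rightarrow> 'w \<Rightarrow> nat"
    and C :: "'n \<Rightarrow> 'w \<Rightarrow> ('n \<Rightarrow> 'x) \<times> (real ^ 'n ^ 'n)"
    and F :: "'w measure"
  assumes "prob_space M"
    and "X \<in> borel_measurable M"
    and "A \<in> borel_measurable M"
    and "\<And>i x a u. u \<in> space V \<Longrightarrow> h i x a u \<in> {0, 1}"
    and "\<And>i. (\<lambda>(x, a, u). h i x a u) \<in> measurable (borel \<Otimes>\<^sub>M borel \<Otimes>\<^sub>M V) (count_space UNIV)"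
    and "\<And>i \<omega>. \<omega> \<in> space M \<Longrightarrow> D i \<omega> = h i (X \<omega>) (A \<omega>) (\<nu> i \<omega>)"
    and "\<And>i \<omega>. \<omega> \<in> space M \<Longrightarrow> C i \<omega> = (X \<omega>, A \<omega>)"
    and "F = vimage_algebra (space M) (\<lambda>\<omega>. (X \<omega>, A \<omega>)) borel"
    and "cond_indep_vars M F (\<lambda>_. V) \<nu> UNIV"
  shows "cond_indep_vars M F (\<lambda>_. count_space UNIV) D UNIV \<and>
    (\<forall>i.
      (\<forall>p. is_cond_pmf M borel (C i) (\<lambda>\<omega> j. D j \<omega>) p \<longrightarrow>
        (AE c in distr M borel (C i). MTP2_on binary_vectors (pmf (p c)))) \<and>
      (\<exists>p. is_cond_pmf M borel (C i) (\<lambda>\<omega> j. D j \<omega>) p \<and>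
        (\<forall>c \<in> rv_support M (C i). MTP2_on binary_vectors (pmf (p c)))))"
proof -
  interpret prob_space M by fact
  define Z where "Z \<omega> = (X \<omega>, A \<omega>)" for \<omega>
  \<comment> \<open>By second countability the Borel sets of the product are generated by
    rectangles, so measurability of the pair follows from that of \<open>X\<close> and
    \<open>A\<close>.\<close>
  have Z: "Z \<in> borel_measurable M"
    unfolding Z_def using assms(2,3) by (simp add: borel_prod[symmetric])
  interpret conditioning M borel Z
    by unfold_locales (rule Z)
  have F_eq: "F = vimage_algebra (space M) Z borel"
    using assms(8) by (simp add: Z_def[abs_def])
  \<comment> \<open>\<open>g\<close> regroups the arguments of \<open>h\<close> so that each
    treatment becomes a function of the pair \<open>(Z, \<nu> i)\<close>.\<close>
  define g where "g i = (\<lambda>(z, u). h i (fst z) (snd z) u)" for i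
  have g: "g i \<in> measurable (borel \<Otimes>\<^sub>M V) (count_space UNIV)" for i
  proof -
    have "(\<lambda>(z, u). (fst z, snd z, u)) \<in>
        measurable ((borel \<Otimes>\<^sub>M borel) \<Otimes>\<^sub>M V) (borel \<Otimes>\<^sub>M borel \<Otimes>\<^sub>M V)"
      by measurable
    from measurable_compose[OF this assms(5)[of i]] show ?thesis
      by (simp add: g_def borel_prod case_prod_beta')
  qed
  have \<nu>: "\<nu> i \<in> measurable M V" for i
    using assms(9) by (simp add: cond_indep_vars_def)
  have D_eq: "D i \<omega> = g i (Z \<omega>, \<nu> i \<omega>)" if "\<omega> \<in> space M" for i \<omega>
    using assms(6)[OF that] by (simp add: g_def Z_def)
  have binary: "D i \<omega> \<in> {0, 1}" if "\<omega> \<in> space M" for i \<omega>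
    using assms(4,6) measurable_space[OF \<nu>] that by simp
  have indep: "cond_indep_vars M F (\<lambda>_. count_space UNIV) D UNIV"
  proof (rule cond_indep_vars_cong)
    show "cond_indep_vars M F (\<lambda>_. count_space UNIV) (\<lambda>i \<omega>. g i (Z \<omega>, \<nu> i \<omega>)) UNIV"
      by (rule cond_indep_vars_compose[OF cond_indep_vars_joint[OF assms(9)[unfolded F_eq], folded F_eq] g])
  qed (rule D_eq)
  have C: "is_cond_pmf M borel (C i) Y p \<longleftrightarrow> is_cond_pmf M borel Z Y p" for i p and Y :: "'w \<Rightarrow> 'n \<Rightarrow> nat"
    using assms(7) by (intro is_cond_pmf_cong) (simp add: Z_def)
  have distr_C: "distr M borel (C i) = distr M borel Z" for i
    using assms(7) by (intro distr_cong) (auto simp: Z_def)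
  obtain p where "is_cond_pmf M borel Z (\<lambda>\<omega> j. D j \<omega>) p" "\<And>c E. MTP2_on E (pmf (p c))"
    using ex_MTP2_cond_pmf[OF indep[unfolded F_eq] binary] by blast
  moreover have "AE c in distr M borel Z. MTP2_on binary_vectors (pmf (p c))"
    if "is_cond_pmf M borel Z (\<lambda>\<omega> j. D j \<omega>) p" for p
    by (rule AE_MTP2_cond_pmf[OF indep[unfolded F_eq] that])
  ultimately show ?thesis
    unfolding C distr_C by (intro conjI indep allI impI exI[of _ p] ballI)
qed

end
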